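(* For every $n\ge 4$, $MC(D_n)=\binom{n}{2}$.
   Context: Let $\Delta$ be a finite irreducible crystallographic root system with a fixed positive system $\Delta^+$ and Weyl group $W$. For $w\in W$ set $N(w)=\{\alpha\in\Delta^+\mid w^{-1}(\alpha)\in-\Delta^+\}$. A subset $Y\subset W$ is inversion complete if $\bigcup_{w\in Y}N(w)=\Delta^+$; it is minimal inversion complete if it is inversion complete and no proper subset of $Y$ is inversion complete. If $\Delta$ is of type $T$, $MC(T)$ denotes the maximal cardinality of a minimal inversion complete subset of $W$. The root system of type $D_n$ is $\Delta=\{\pm(\epsilon_i\pm\epsilon_j)\mid 1\le i<j\le n\}\subset\mathbb{R}^n$, where $\{\epsilon_i\}$ is the standard basis, with $\Delta^+=\{\epsilon_i\pm\epsilon_j\mid 1\le i<j\le n\}$. *)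

theory Defs
  imports "HOL-Analysis.Analysis"
begin

definition root_reflection :: "'a::real_inner \<Rightarrow> 'a \<Rightarrow> 'a" where
  "root_reflection \<alpha> v = v - (2 * (v \<bullet> \<alpha>) / (\<alpha> \<bullet> \<alpha>)) *\<^sub>R \<alpha>"

text \<open>The group of transformations of the ambient space generated by the reflections in the
  roots; its elements are bijections, so the inverse in the group is \<open>inv\<close>.\<close>

inductive_set weyl_group :: "'a::real_inner set \<Rightarrow> ('a \<Rightarrow> 'a) set" for \<Delta> :: "'a set" where
  weyl_id: "id \<in> weyl_group \<Delta>"
| weyl_reflection: "\<alpha> \<in> \<Delta> \<Longrightarrow> root_reflection \<alpha> \<in> weyl_group \<Delta>"
| weyl_comp: "v \<in> weyl_group \<Delta> \<Longrightarrow> w \<in> weyl_group \<Delta> \<Longrightarrow> v \<circ> w \<in> weyl_group \<Delta>"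
| weyl_inv: "w \<in> weyl_group \<Delta> \<Longrightarrow> inv w \<in> weyl_group \<Delta>"

text \<open>Below, \<open>\<Delta>\<close> is a root system and \<open>P\<close> is its fixed positive system.\<close>

definition inversion_set :: "'a::real_inner set \<Rightarrow> ('a \<Rightarrow> 'a) \<Rightarrow> 'a set" where
  "inversion_set P w = {\<alpha> \<in> P. inv w \<alpha> \<in> uminus ` P}"

definition inversion_complete ::
    "'a::real_inner set \<Rightarrow> 'a set \<Rightarrow> ('a \<Rightarrow> 'a) set \<Rightarrow> bool" where
  "inversion_complete \<Delta> P Y \<longleftrightarrow>
     Y \<subseteq> weyl_group \<Delta> \<and> (\<Union>w\<in>Y. inversion_set P w) = P"

definition minimal_inversion_complete ::
    "'a::real_inner set \<Rightarrow> 'a set \<Rightarrow> ('a \<Rightarrow> 'a) set \<Rightarrow> bool" where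
  "minimal_inversion_complete \<Delta> P Y \<longleftrightarrow>
     inversion_complete \<Delta> P Y \<and> (\<forall>Z. Z \<subset> Y \<longrightarrow> \<not> inversion_complete \<Delta> P Z)"

text \<open>The maximum is taken over a finite nonempty set whenever \<open>\<Delta>\<close> is a finite root system,
  since the Weyl group is then finite and contains the longest element.\<close>

definition MC :: "'a::real_inner set \<Rightarrow> 'a set \<Rightarrow> nat" where
  "MC \<Delta> P = Max {card Y | Y. minimal_inversion_complete \<Delta> P Y}"

text \<open>The root system of type \<open>D\<^sub>n\<close>, relative to vectors \<open>\<epsilon> 1, \<dots>, \<epsilon> n\<close>, which are meant to
  be the standard basis vectors of \<open>n\<close>-dimensional Euclidean space.\<close>

definition D_pos_roots :: "nat \<Rightarrow> (nat \<Rightarrow> 'a::real_inner) \<Rightarrow> 'a set" where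
  "D_pos_roots n \<epsilon> =
     {\<epsilon> i + \<epsilon> j | i j. 1 \<le> i \<and> i < j \<and> j \<le> n} \<union>
     {\<epsilon> i - \<epsilon> j | i j. 1 \<le> i \<and> i < j \<and> j \<le> n}"

definition D_roots :: "nat \<Rightarrow> (nat \<Rightarrow> 'a::real_inner) \<Rightarrow> 'a set" where
  "D_roots n \<epsilon> = D_pos_roots n \<epsilon> \<union> uminus ` D_pos_roots n \<epsilon>"

end

theory Submission
  imports Defs "HOL-Combinatorics.Transposition"
begin

text \<open>A minimal inversion complete set \<open>Y\<close> has the same size as a set \<open>X\<close> of positive roots, one
  private root of each \<open>w \<in> Y\<close>. Since \<open>N(w)\<close> is where the functional \<open>w \<rho>\<close> is negative, every
  positive root is negative for some functional that is positive on \<open>X\<close> minus one point. Call a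
  pair \<open>i < j\<close> double if both \<open>\<epsilon>\<^sub>i \<plusminus> \<epsilon>\<^sub>j\<close> lie in \<open>X\<close>, and missing if neither does. Relations
  between roots show that double pairs have distinct larger indices, that no larger index is also a
  smaller one, and that every triangle over a double pair has a missing side. For \<open>n \<ge> 4\<close> this
  gives at least as many missing pairs as double ones, whence the upper bound. It is attained by
  elements \<open>w\<^sub>k\<^sub>l\<close> (\<open>k < l\<close>) for which \<open>w\<^sub>k\<^sub>l \<rho>\<close> has coordinates \<open>- 1\<close> at \<open>k\<close>, \<open>0\<close> at \<open>l\<close> and
  at least \<open>2\<close> elsewhere: \<open>w\<^sub>k\<^sub>l\<close> inverts \<open>\<epsilon>\<^sub>k \<plusminus> \<epsilon>\<^sub>l\<close> and is the only one to invert
  \<open>\<epsilon>\<^sub>k + \<epsilon>\<^sub>l\<close>.\<close>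

section \<open>Separated sets of positive roots\<close>

text \<open>With values in any abelian group, one function gives both a root (\<open>c\<close> the
  basis) and the value at that root of the functional with coordinates \<open>c\<close>.\<close>

fun root_value :: "(nat \<Rightarrow> 'a::ab_group_add) \<Rightarrow> nat \<times> nat \<times> bool \<Rightarrow> 'a" where
  "root_value c (i, j, s) = (if s then c i + c j else c i - c j)"

definition root_labels :: "nat \<Rightarrow> (nat \<times> nat \<times> bool) set" where
  "root_labels n = {(i, j, s). 1 \<le> i \<and> i < j \<and> j \<le> n}"

lemma root_labels_iff [simp]: "(i, j, s) \<in> root_labels n \<longleftrightarrow> 1 \<le> i \<and> i < j \<and> j \<le> n"
  by (simp add: root_labels_def)

lemma finite_root_labels: "finite (root_labels n)"
proof (rule finite_subset)
  show "root_labels n \<subseteq> {..n} \<times> {..n} \<times> UNIV"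
    by (auto simp: root_labels_def)
qed auto

text \<open>The exempt label \<open>x\<close> may depend on \<open>t\<close>; in the application it
  is the private root of an element that inverts \<open>t\<close>.\<close>

locale separated_labels =
  fixes n :: nat and X :: "(nat \<times> nat \<times> bool) set"
  assumes labels: "X \<subseteq> root_labels n"
    and separated: "t \<in> root_labels n \<Longrightarrow>
      \<exists>c :: nat \<Rightarrow> real. \<exists>x. root_value c t < 0 \<and> (\<forall>y\<in>X - {x}. root_value c y > 0)"
begin

definition double :: "nat \<Rightarrow> nat \<Rightarrow> bool" where
  "double i j \<longleftrightarrow> (i, j, True) \<in> X \<and> (i, j, False) \<in> X"

definition joined :: "nat set set" where
  "joined = {{i, j} | i j s. (i, j, s) \<in> X}"

lemma finite_X: "finite X"
  using labels finite_root_labels by (rule finite_subset)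

text \<open>Members of \<open>X\<close> other than the exempt one have positive value, so a member
  with negative value is itself the exempt one.\<close>

lemma separated_member:
  assumes "x \<in> X"
  shows "\<exists>c :: nat \<Rightarrow> real. root_value c x < 0 \<and> (\<forall>y\<in>X - {x}. root_value c y > 0)"
proof -
  obtain c :: "nat \<Rightarrow> real" and z where "root_value c x < 0" "\<forall>y\<in>X - {z}. root_value c y > 0"
    using separated assms labels by blast
  moreover from this have "z = x"
    using assms by (metis Diff_iff not_less_iff_gr_or_eq singletonD)
  ultimately show ?thesis by blast
qed

section \<open>Root relations that restrict double pairs\<close>

lemma double_less: "double i j \<Longrightarrow> 1 \<le> i \<and> i < j \<and> j \<le> n"
  using labels by (auto simp: double_def)

text \<open>\<open>\<epsilon>\<^sub>i + \<epsilon>\<^sub>j\<close> is the sum of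
  \<open>\<epsilon>\<^sub>i - \<epsilon>\<^sub>j\<close> and the two roots of the pair
  \<open>j\<close>, \<open>l\<close>, so it cannot be negative alone.\<close>

lemma no_double_chain:
  assumes "double i j" "double j l"
  shows False
proof -
  have ord: "i < j" "j < l"
    using assms double_less by auto
  obtain c :: "nat \<Rightarrow> real" where c: "root_value c (i, j, True) < 0"
      "\<forall>y\<in>X - {(i, j, True)}. root_value c y > 0"
    using separated_member assms(1) unfolding double_def by blast
  have "root_value c (i, j, False) > 0" "root_value c (j, l, True) > 0"
      "root_value c (j, l, False) > 0"
    using c(2) assms ord by (auto simp: double_def simp del: root_value.simps)
  with c(1) show False by simp
qed

text \<open>If \<open>\<epsilon>\<^sub>i \<plusminus> \<epsilon>\<^sub>j\<close> and \<open>\<epsilon>\<^sub>k \<plusminus> \<epsilon>\<^sub>j\<close> all lie in the set, then \<open>\<epsilon>\<^sub>i + \<epsilon>\<^sub>k\<close> is a sum of elements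
  of the set in two disjoint ways, so making it negative costs two negative elements.\<close>

lemma double_unique:
  assumes "double i j" "double k j"
  shows "i = k"
proof (rule ccontr)
  assume "i \<noteq> k"
  have ord: "1 \<le> i" "i < j" "1 \<le> k" "k < j" "j \<le> n"
    using assms double_less by auto
  have "(min i k, max i k, True) \<in> root_labels n"
    using ord \<open>i \<noteq> k\<close> by (auto simp: min_def max_def)
  from separated[OF this] obtain c :: "nat \<Rightarrow> real" and x
    where c: "root_value c (min i k, max i k, True) < 0" "\<forall>y\<in>X - {x}. root_value c y > 0"
    by blast
  have sum: "c i + c k < 0"
    using c(1) by (auto simp: min_def max_def split: if_splits)
  have "(i, j, True) \<noteq> x \<and> (k, j, False) \<noteq> x \<or> (i, j, False) \<noteq> x \<and> (k, j, True) \<noteq> x"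
    using \<open>i \<noteq> k\<close> by auto
  then show False
  proof
    assume "(i, j, True) \<noteq> x \<and> (k, j, False) \<noteq> x"
    then have "root_value c (i, j, True) > 0" "root_value c (k, j, False) > 0"
      using c(2) assms by (auto simp: double_def simp del: root_value.simps)
    with sum show False by simp
  next
    assume "(i, j, False) \<noteq> x \<and> (k, j, True) \<noteq> x"
    then have "root_value c (i, j, False) > 0" "root_value c (k, j, True) > 0"
      using c(2) assms by (auto simp: double_def simp del: root_value.simps)
    with sum show False by simp
  qed
qed

lemma joinedE:
  assumes "{i, j} \<in> joined" "i \<noteq> j"
  obtains s where "(min i j, max i j, s) \<in> X"
proof -
  obtain a b s where ab: "{i, j} = {a, b}" "(a, b, s) \<in> X"
    using assms(1) by (auto simp: joined_def)
  have "a < b" using ab(2) labels by auto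
  with ab(1) have "a = min i j" "b = max i j"
    by (auto simp: doubleton_eq_iff min_def max_def)
  with ab(2) that show thesis by blast
qed

text \<open>Among the two roots of the double pair and one root on each of the other two sides of a
  triangle, one is always a sum of two others.\<close>

lemma double_triangle:
  assumes d: "double i j" and k: "k \<noteq> i" "k \<noteq> j"
    and ik: "{i, k} \<in> joined" and jk: "{j, k} \<in> joined"
  shows False
proof -
  have "i < j" using d double_less by auto
  obtain s where p: "(min i k, max i k, s) \<in> X" (is "?p \<in> X")
    using joinedE[OF ik] k by auto
  obtain t where q: "(min j k, max j k, t) \<in> X" (is "?q \<in> X")
    using joinedE[OF jk] k by auto
  have u: "(i, j, True) \<in> X" and v: "(i, j, False) \<in> X"
    using d by (auto simp: double_def)
  have ne: "?p \<noteq> (i, j, True)" "?p \<noteq> (i, j, False)" "?q \<noteq> (i, j, True)" "?q \<noteq> (i, j, False)" "?p \<noteq> ?q"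
    using k \<open>i < j\<close> by (auto simp: min_def max_def)
  have sep: "\<exists>c :: nat \<Rightarrow> real. root_value c x < 0 \<and> (x \<noteq> ?p \<longrightarrow> root_value c ?p > 0)
      \<and> (x \<noteq> ?q \<longrightarrow> root_value c ?q > 0) \<and> (x \<noteq> (i, j, True) \<longrightarrow> root_value c (i, j, True) > 0)
      \<and> (x \<noteq> (i, j, False) \<longrightarrow> root_value c (i, j, False) > 0)" if "x \<in> X" for x
    using separated_member[OF that] p q u v by blast
  \<comment> \<open>Which of the four roots is a sum depends on the position of \<open>k\<close> and
    on \<open>s\<close>, \<open>t\<close>; each gets a functional negative at it and positive at the
    other three.\<close>
  obtain c1 :: "nat \<Rightarrow> real" where c1: "root_value c1 ?p < 0" "root_value c1 ?q > 0"
      "root_value c1 (i, j, True) > 0" "root_value c1 (i, j, False) > 0"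
    using sep[OF p] ne by metis
  obtain c2 :: "nat \<Rightarrow> real" where c2: "root_value c2 ?q < 0" "root_value c2 ?p > 0"
      "root_value c2 (i, j, True) > 0" "root_value c2 (i, j, False) > 0"
    using sep[OF q] ne by metis
  obtain c3 :: "nat \<Rightarrow> real" where c3: "root_value c3 (i, j, True) < 0" "root_value c3 ?p > 0"
      "root_value c3 ?q > 0" "root_value c3 (i, j, False) > 0"
    using sep[OF u] ne by auto
  obtain c4 :: "nat \<Rightarrow> real" where c4: "root_value c4 (i, j, False) < 0" "root_value c4 ?p > 0"
      "root_value c4 ?q > 0" "root_value c4 (i, j, True) > 0"
    using sep[OF v] ne by auto
  consider "k < i" | "i < k" "k < j" | "j < k"
    using k by linarith
  then show False
    using c1 c2 c3 c4 \<open>i < j\<close> by cases (cases s; cases t; simp)+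
qed

section \<open>Counting double and missing pairs\<close>

definition missing :: "nat set set" where
  "missing = {B. B \<subseteq> {1..n} \<and> card B = 2} - joined"

definition doubles :: "(nat \<times> nat) set" where
  "doubles = {(i, j). double i j}"

lemma joined_subset: "joined \<subseteq> {B. B \<subseteq> {1..n} \<and> card B = 2}"
proof -
  have "{i, j} \<subseteq> {1..n} \<and> card {i, j} = 2" if "(i, j, s) \<in> X" for i j s
  proof -
    have "1 \<le> i \<and> i < j \<and> j \<le> n" using labels that by auto
    then show ?thesis by auto
  qed
  then show ?thesis
    by (auto simp: joined_def simp del: insert_subset)
qed

lemma finite_pairs: "finite {B. B \<subseteq> {1..n} \<and> card B = 2}"
  by (rule finite_subset[of _ "Pow {1..n}"]) auto

text \<open>Inclusion-exclusion for the pairs carrying a plus root and those carrying a minus root: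
  the union corresponds to \<open>joined\<close>, the intersection is
  \<open>doubles\<close>.\<close>

lemma card_X: "card X = card joined + card doubles"
proof -
  define E where "E s = {(i, j). (i, j, s) \<in> X}" for s
  have finE: "finite (E s)" for s
  proof -
    have "E s = (\<lambda>x. (fst x, fst (snd x))) ` {x \<in> X. snd (snd x) = s}"
      by (force simp: E_def)
    then show ?thesis using finite_X by simp
  qed
  have X_eq: "X = (\<lambda>(i, j). (i, j, True)) ` E True \<union> (\<lambda>(i, j). (i, j, False)) ` E False"
  proof -
    have "x \<in> (\<lambda>(i, j). (i, j, True)) ` E True \<union> (\<lambda>(i, j). (i, j, False)) ` E False"
      if "x \<in> X" for x
      using that by (cases x; cases "snd (snd x)") (auto simp: E_def image_iff)
    then show ?thesis by (auto simp: E_def)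
  qed
  have "card X = card (E True) + card (E False)"
  proof -
    have "card ((\<lambda>(i, j). (i, j, True)) ` E True) = card (E True)"
      "card ((\<lambda>(i, j). (i, j, False)) ` E False) = card (E False)"
      by (auto intro!: card_image simp: inj_on_def)
    moreover have "(\<lambda>(i, j). (i, j, True)) ` E True \<inter> (\<lambda>(i, j). (i, j, False)) ` E False = {}"
      by auto
    ultimately show ?thesis
      using X_eq card_Un_disjoint[OF finite_imageI[OF finE] finite_imageI[OF finE]] by metis
  qed
  also have "\<dots> = card (E True \<union> E False) + card (E True \<inter> E False)"
    by (rule card_Un_Int[OF finE finE])
  also have "E True \<inter> E False = doubles"
    by (auto simp: E_def doubles_def double_def)
  also have "card (E True \<union> E False) = card joined"
  proof (rule bij_betw_same_card)
    have less: "i < j" if "(i, j) \<in> E True \<union> E False" for i j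
      using that labels by (auto simp: E_def)
    have "inj_on (\<lambda>(i, j). {i, j}) (E True \<union> E False)"
    proof (rule inj_onI)
      fix p q assume pq: "p \<in> E True \<union> E False" "q \<in> E True \<union> E False"
        and eq: "(\<lambda>(i, j). {i, j}) p = (\<lambda>(i, j). {i, j}) q"
      obtain a b a' b' where p: "p = (a, b)" "q = (a', b')" by (cases p, cases q)
      have "a < b" "a' < b'" using less pq unfolding p by blast+
      then show "p = q" using eq by (auto simp: p doubleton_eq_iff)
    qed
    moreover have "(\<lambda>(i, j). {i, j}) ` (E True \<union> E False) = joined"
    proof -
      have "(i, j) \<in> E True \<union> E False" if "(i, j, s) \<in> X" for i j s
        using that by (cases s) (auto simp: E_def)
      then have "joined \<subseteq> (\<lambda>(i, j). {i, j}) ` (E True \<union> E False)"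
        by (force simp: joined_def)
      moreover have "(\<lambda>(i, j). {i, j}) ` (E True \<union> E False) \<subseteq> joined"
        by (auto simp: joined_def E_def)
      ultimately show ?thesis by blast
    qed
    ultimately show "bij_betw (\<lambda>(i, j). {i, j}) (E True \<union> E False) joined"
      by (simp add: bij_betw_def)
  qed
  finally show ?thesis .
qed

text \<open>Each further index \<open>k\<close> spans a triangle over the double pair with a missing
  side, and the sides chosen for different \<open>k\<close> differ.\<close>

lemma card_missing_ge:
  assumes d: "double i j"
  shows "n - 2 \<le> card missing"
proof -
  have ij: "1 \<le> i" "i < j" "j \<le> n" using double_less[OF d] by auto
  define g where "g k = (if {i, k} \<in> joined then {j, k} else {i, k})" for k
  have "inj_on g ({1..n} - {i, j})"
    by (auto simp: inj_on_def g_def doubleton_eq_iff split: if_splits)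
  moreover have "g ` ({1..n} - {i, j}) \<subseteq> missing"
  proof (rule image_subsetI)
    fix k assume k: "k \<in> {1..n} - {i, j}"
    then have "g k \<notin> joined"
      using double_triangle[OF d, of k] by (auto simp: g_def)
    then show "g k \<in> missing"
      using k ij by (auto simp: missing_def g_def)
  qed
  ultimately have "card ({1..n} - {i, j}) \<le> card missing"
    using finite_pairs by (intro card_inj_on_le[of g]) (auto simp: missing_def)
  then show ?thesis using ij by (simp add: card_Diff_subset)
qed

text \<open>The larger indices of double pairs are distinct and avoid \<open>i\<close>, so there are
  at most \<open>n - 1\<close> double pairs. If there are fewer, the \<open>n - 2\<close> missing
  pairs of \<open>card_missing_ge\<close> suffice; otherwise the double pairs form a star centred at
  \<open>i\<close>, and all pairs avoiding \<open>i\<close> are missing.\<close>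

lemma card_doubles_le_missing:
  assumes n: "n \<ge> 4"
  shows "card doubles \<le> card missing"
proof (cases "doubles = {}")
  case False
  then obtain i j where d: "double i j" by (auto simp: doubles_def)
  have ij: "1 \<le> i" "i < j" "j \<le> n" using double_less[OF d] by auto
  have inj: "inj_on snd doubles"
    using double_unique by (auto simp: inj_on_def doubles_def)
  have sub: "snd ` doubles \<subseteq> {1..n} - {i}"
    using no_double_chain[OF _ d] double_less by (fastforce simp: doubles_def)
  have card_snd: "card doubles = card (snd ` doubles)"
    using inj by (simp add: card_image)
  have card_V: "card ({1..n} - {i}) = n - 1"
    using ij by simp
  show ?thesis
  proof (cases "snd ` doubles = {1..n} - {i}")
    case True
    \<comment> \<open>Every index but \<open>i\<close> is a larger one, while a smaller index
      \<open>k\<close> is never a larger one; hence \<open>k = i\<close>.\<close>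
    have star: "double i l" if l: "l \<in> {1..n} - {i}" for l
    proof -
      obtain k where k: "double k l"
        using l unfolding True[symmetric] by (auto simp: doubles_def)
      have "k \<notin> snd ` doubles"
        using no_double_chain[OF _ k] by (auto simp: doubles_def)
      with True double_less[OF k] have "k = i" by auto
      with k show ?thesis by simp
    qed
    have "{B. B \<subseteq> {1..n} - {i} \<and> card B = 2} \<subseteq> missing"
    proof
      fix B assume "B \<in> {B. B \<subseteq> {1..n} - {i} \<and> card B = 2}"
      then obtain a b where B: "B = {a, b}" "a \<noteq> b" and
        ab: "a \<in> {1..n} - {i}" "b \<in> {1..n} - {i}"
        by (auto simp: card_2_iff)
      have "{i, b} \<in> joined"
        using star[OF ab(2)] by (auto simp: joined_def double_def)
      then have "{a, b} \<notin> joined"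
        using double_triangle[OF star[OF ab(1)], of b] B ab by auto
      with B ab show "B \<in> missing"
        by (auto simp: missing_def)
    qed
    then have "card {B. B \<subseteq> {1..n} - {i} \<and> card B = 2} \<le> card missing"
      using finite_pairs by (intro card_mono) (auto simp: missing_def)
    then have "(n - 1) choose 2 \<le> card missing"
      using n_subsets[of "{1..n} - {i}" 2] card_V by simp
    \<comment> \<open>Here \<open>n \<ge> 4\<close> enters: \<open>(n - 1) choose 2\<close> is
      \<open>(n - 1) * (n - 2) / 2\<close>, and \<open>n - 2\<close> is at least 2.\<close>
    moreover have "n - 1 \<le> (n - 1) choose 2"
    proof -
      obtain m where m: "n = m + 4" using n by (metis add.commute le_Suc_ex)
      have "(m + 3) * 2 \<le> (m + 3) * (m + 2)" by (intro mult_left_mono) auto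
      then show ?thesis by (simp add: m choose_two)
    qed
    ultimately show ?thesis using card_snd card_V True by simp
  next
    case False
    then have "card (snd ` doubles) < n - 1"
      using sub card_V by (metis finite_Diff finite_atLeastAtMost psubsetI psubset_card_mono)
    then show ?thesis using card_snd card_missing_ge[OF d] by simp
  qed
qed simp

text \<open>Joined and missing pairs together number \<open>n choose 2\<close>, and the second label
  on each double pair is paid for by a missing pair.\<close>

lemma card_le:
  assumes "n \<ge> 4"
  shows "card X \<le> n choose 2"
proof -
  have fin: "finite joined"
    using joined_subset finite_pairs by (rule finite_subset)
  have "card missing = (n choose 2) - card joined"
    using card_Diff_subset[OF fin joined_subset] n_subsets[of "{1..n}" 2]
    by (simp add: missing_def)
  moreover have "card joined \<le> n choose 2"
    using card_mono[OF finite_pairs joined_subset] n_subsets[of "{1..n}" 2] by simp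
  ultimately show ?thesis
    using card_X card_doubles_le_missing[OF assms] by simp
qed

end

section \<open>The Weyl group of type D\<close>

lemma root_reflection_involutive: "root_reflection \<alpha> (root_reflection \<alpha> v) = v"
  by (cases "\<alpha> = 0") (simp_all add: root_reflection_def inner_diff_left field_simps)

lemma inner_root_reflection: "root_reflection \<alpha> u \<bullet> root_reflection \<alpha> v = u \<bullet> v"
  by (cases "\<alpha> = 0")
    (simp_all add: root_reflection_def inner_diff_left inner_diff_right inner_commute field_simps)

lemma linear_root_reflection: "linear (root_reflection \<alpha>)"
  by (rule linearI)
    (simp_all add: root_reflection_def inner_add_left algebra_simps add_divide_distrib)

lemma inner_root_value: "v \<bullet> root_value \<epsilon> t = root_value (\<lambda>m. v \<bullet> \<epsilon> m) t"
  by (cases t) (simp add: inner_add_right inner_diff_right)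

abbreviation transposition :: "'a \<Rightarrow> 'a \<Rightarrow> 'a \<Rightarrow> 'a" where
  "transposition \<equiv> Transposition.transpose"

lemmas transposition_def = Transposition.transpose_def

locale D_system =
  fixes n :: nat and \<epsilon> :: "nat \<Rightarrow> 'a::real_inner"
  assumes orthonormal: "i \<in> {1..n} \<Longrightarrow> j \<in> {1..n} \<Longrightarrow> \<epsilon> i \<bullet> \<epsilon> j = (if i = j then 1 else 0)"
begin

abbreviation \<Phi> :: "'a set" where "\<Phi> \<equiv> D_roots n \<epsilon>"
abbreviation \<Phi>p :: "'a set" where "\<Phi>p \<equiv> D_pos_roots n \<epsilon>"

lemma D_pos_roots_image: "\<Phi>p = root_value \<epsilon> ` root_labels n"
proof (rule set_eqI)
  fix x
  have "x \<in> root_value \<epsilon> ` root_labels n \<longleftrightarrow>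
      (\<exists>i j s. 1 \<le> i \<and> i < j \<and> j \<le> n \<and> x = root_value \<epsilon> (i, j, s))"
    unfolding image_iff root_labels_def by blast
  then show "x \<in> \<Phi>p \<longleftrightarrow> x \<in> root_value \<epsilon> ` root_labels n"
    unfolding D_pos_roots_def ex_bool_eq root_value.simps if_True if_False by blast
qed

text \<open>The indices may come in either order and each carries its own sign, a form that signed
  permutations of the basis preserve without case distinctions.\<close>

definition signed_root :: "real \<Rightarrow> nat \<Rightarrow> real \<Rightarrow> nat \<Rightarrow> 'a" where
  "signed_root s i t j = s *\<^sub>R \<epsilon> i + t *\<^sub>R \<epsilon> j"

definition is_sign :: "real \<Rightarrow> bool" where
  "is_sign s \<longleftrightarrow> s = 1 \<or> s = - 1"

lemma D_roots_signed:
  "\<Phi> = {signed_root s i t j | s i t j. is_sign s \<and> is_sign t \<and> i \<in> {1..n} \<and> j \<in> {1..n} \<and> i \<noteq> j}"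
  (is "_ = ?R")
proof
  have pos: "signed_root s i t j \<in> ?R" if "is_sign s" "is_sign t" "1 \<le> i" "i < j" "j \<le> n" for s t i j
    using that by fastforce
  have "x \<in> ?R \<and> - x \<in> ?R" if x: "x \<in> \<Phi>p" for x
  proof -
    obtain i j where ij: "1 \<le> i" "i < j" "j \<le> n" "x = \<epsilon> i + \<epsilon> j \<or> x = \<epsilon> i - \<epsilon> j"
      using x unfolding D_pos_roots_def by blast
    obtain t where t: "is_sign t" "is_sign (- t)" "x = signed_root 1 i t j"
      using ij(4) by (auto simp: signed_root_def is_sign_def intro: that[of 1] that[of "- 1"])
    then have x': "- x = signed_root (- 1) i (- t) j"
      by (simp add: signed_root_def)
    have "is_sign 1" "is_sign (- 1)" by (simp_all add: is_sign_def)
    then show ?thesis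
      unfolding x' unfolding t(3) by (intro conjI pos t ij)
  qed
  then show "\<Phi> \<subseteq> ?R" unfolding D_roots_def by blast
  have root: "signed_root s i t j \<in> \<Phi>" if "is_sign s" "is_sign t" "1 \<le> i" "i < j" "j \<le> n" for s t i j
  proof -
    have "\<epsilon> i + \<epsilon> j \<in> \<Phi>p" "\<epsilon> i - \<epsilon> j \<in> \<Phi>p"
      using that by (auto simp: D_pos_roots_def)
    then have "\<epsilon> i + \<epsilon> j \<in> \<Phi>" "\<epsilon> i - \<epsilon> j \<in> \<Phi>" "- (\<epsilon> i + \<epsilon> j) \<in> \<Phi>" "- (\<epsilon> i - \<epsilon> j) \<in> \<Phi>"
      unfolding D_roots_def by blast+
    then show ?thesis
      using that(1,2) by (auto simp: is_sign_def signed_root_def)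
  qed
  show "?R \<subseteq> \<Phi>"
  proof clarify
    fix s t and i j :: nat
    assume st: "is_sign s" "is_sign t" and ij: "i \<in> {1..n}" "j \<in> {1..n}" "i \<noteq> j"
    show "signed_root s i t j \<in> \<Phi>"
    proof (cases "i < j")
      case True
      show ?thesis by (rule root) (use st ij True in auto)
    next
      case False
      have "signed_root t j s i \<in> \<Phi>" by (rule root) (use st ij False in auto)
      then show ?thesis by (simp add: signed_root_def add.commute)
    qed
  qed
qed

text \<open>The root has squared length 2, so its reflection is a signed transposition: it exchanges
  \<open>\<epsilon> i\<close> and \<open>\<epsilon> j\<close> up to the factor
  \<open>- (s * t)\<close>.\<close>

lemma root_reflection_basis:
  assumes "is_sign s" "is_sign t" "i \<in> {1..n}" "j \<in> {1..n}" "i \<noteq> j" "m \<in> {1..n}"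
  shows "root_reflection (signed_root s i t j) (\<epsilon> m) =
    (if m \<in> {i, j} then - (s * t) else 1) *\<^sub>R \<epsilon> (transposition i j m)"
proof -
  have "signed_root s i t j \<bullet> signed_root s i t j = 2"
    using assms by (auto simp: signed_root_def is_sign_def inner_add_left inner_add_right
        inner_diff_left inner_diff_right orthonormal)
  moreover have "\<epsilon> m \<bullet> signed_root s i t j = (if m = i then s else if m = j then t else 0)"
    using assms by (auto simp: signed_root_def inner_add_right orthonormal)
  ultimately show ?thesis
    using assms by (auto simp: root_reflection_def signed_root_def is_sign_def transposition_def)
qed

lemma root_reflection_roots:
  assumes "\<alpha> \<in> \<Phi>"
  shows "root_reflection \<alpha> ` \<Phi> = \<Phi>"
proof -
  obtain s i t j where \<alpha>: "\<alpha> = signed_root s i t j" and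
    st: "is_sign s" "is_sign t" "i \<in> {1..n}" "j \<in> {1..n}" "i \<noteq> j"
    using assms unfolding D_roots_signed by blast
  have sub: "root_reflection \<alpha> \<beta> \<in> \<Phi>" if \<beta>_in: "\<beta> \<in> \<Phi>" for \<beta>
  proof -
    obtain s' k t' l where \<beta>: "\<beta> = signed_root s' k t' l" and
      kl: "is_sign s'" "is_sign t'" "k \<in> {1..n}" "l \<in> {1..n}" "k \<noteq> l"
      using \<beta>_in unfolding D_roots_signed by blast
    define c where "c m = (if m \<in> {i, j} then - (s * t) else 1)" for m
    have c: "is_sign (r * c m)" if "is_sign r" for r m
      using that st by (auto simp: c_def is_sign_def)
    have "root_reflection \<alpha> \<beta> = signed_root (s' * c k) (transposition i j k)
        (t' * c l) (transposition i j l)"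
      unfolding \<alpha> \<beta> signed_root_def[of s' k] linear_add[OF linear_root_reflection]
        linear_scale[OF linear_root_reflection]
      by (simp only: root_reflection_basis[OF st kl(3)] root_reflection_basis[OF st kl(4)]
          c_def signed_root_def[of "_ * _"] scaleR_scaleR)
    moreover have "transposition i j k \<noteq> transposition i j l"
      using kl by (metis transpose_involutory)
    moreover have "transposition i j k \<in> {1..n}" "transposition i j l \<in> {1..n}"
      using kl st by (auto simp: transposition_def)
    ultimately show ?thesis
      unfolding D_roots_signed using c kl by blast
  qed
  \<comment> \<open>An involution that maps \<open>\<Phi>\<close> into itself maps it onto
    itself.\<close>
  then have "\<Phi> \<subseteq> root_reflection \<alpha> ` \<Phi>"
    by (metis imageI root_reflection_involutive subsetI)
  with sub show ?thesis by blast
qed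

text \<open>The three properties are proved together because the inverse case of the induction draws
  on bijectivity for the other two.\<close>

lemma weyl_group_isometry:
  assumes "w \<in> weyl_group \<Phi>"
  shows "bij w \<and> (\<forall>u v. w u \<bullet> w v = u \<bullet> v) \<and> w ` \<Phi> = \<Phi>"
  using assms
proof induction
  case weyl_id
  show ?case by (intro conjI bij_id) simp_all
next
  case (weyl_reflection \<alpha>)
  then show ?case
    by (auto simp: root_reflection_roots inner_root_reflection
        intro!: o_bij[of "root_reflection \<alpha>"] simp: fun_eq_iff root_reflection_involutive)
next
  case (weyl_comp v w)
  then show ?case
    by (metis bij_comp comp_apply image_comp)
next
  case (weyl_inv w)
  then have "inv w u \<bullet> inv w v = u \<bullet> v" for u v
    by (metis bij_inv_eq_iff)
  moreover have "inv w ` \<Phi> = \<Phi>"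
    using weyl_inv image_inv_f_f[of w \<Phi>] by (simp add: bij_is_inj)
  ultimately show ?case
    using weyl_inv by (simp add: bij_imp_bij_inv)
qed

section \<open>Inversion sets through the functional \<open>w \<rho>\<close>\<close>

definition \<rho> :: 'a where "\<rho> = (\<Sum>m\<in>{1..n}. real (n - m) *\<^sub>R \<epsilon> m)"

lemma \<rho>_basis: "i \<in> {1..n} \<Longrightarrow> \<rho> \<bullet> \<epsilon> i = real (n - i)"
proof -
  assume i: "i \<in> {1..n}"
  have "\<rho> \<bullet> \<epsilon> i = (\<Sum>m\<in>{1..n}. if m = i then real (n - m) else 0)"
    unfolding \<rho>_def inner_sum_left using i by (intro sum.cong) (auto simp: orthonormal)
  then show ?thesis using i by simp
qed

text \<open>\<open>\<rho>\<close> is half the sum of the positive roots; its coordinates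
  \<open>n - 1\<close>, ..., \<open>0\<close> are nonnegative and strictly decreasing.\<close>

lemma \<rho>_pos: "\<beta> \<in> \<Phi>p \<Longrightarrow> \<rho> \<bullet> \<beta> > 0"
  unfolding D_pos_roots_def
  by (auto simp: inner_add_right inner_diff_right \<rho>_basis of_nat_diff)

text \<open>As \<open>w\<close> is an isometry, \<open>w \<rho>\<close> takes at a root the value of
  \<open>\<rho>\<close> at its preimage under \<open>w\<close>, which is again a root and whose sign
  \<open>\<rho>\<close> detects.\<close>

lemma inversion_value:
  assumes w: "w \<in> weyl_group \<Phi>" and t: "t \<in> root_labels n"
  shows "root_value \<epsilon> t \<in> inversion_set \<Phi>p w \<Longrightarrow> root_value (\<lambda>m. w \<rho> \<bullet> \<epsilon> m) t < 0"
    and "root_value \<epsilon> t \<notin> inversion_set \<Phi>p w \<Longrightarrow> root_value (\<lambda>m. w \<rho> \<bullet> \<epsilon> m) t > 0"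
proof -
  let ?\<beta> = "inv w (root_value \<epsilon> t)"
  have pos: "root_value \<epsilon> t \<in> \<Phi>p" using t by (simp add: D_pos_roots_image)
  have "inv w \<in> weyl_group \<Phi>" using w by (rule weyl_group.weyl_inv)
  then have root: "?\<beta> \<in> \<Phi>p \<union> uminus ` \<Phi>p"
    using pos weyl_group_isometry[of "inv w"] by (auto simp: D_roots_def)
  have "root_value (\<lambda>m. w \<rho> \<bullet> \<epsilon> m) t = w \<rho> \<bullet> w ?\<beta>"
    using weyl_group_isometry[OF w] by (simp add: inner_root_value bij_is_surj surj_f_inv_f)
  also have "\<dots> = \<rho> \<bullet> ?\<beta>"
    using weyl_group_isometry[OF w] by blast
  finally have eq: "root_value (\<lambda>m. w \<rho> \<bullet> \<epsilon> m) t = \<rho> \<bullet> ?\<beta>" .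
  show "root_value (\<lambda>m. w \<rho> \<bullet> \<epsilon> m) t < 0" if inv: "root_value \<epsilon> t \<in> inversion_set \<Phi>p w"
  proof -
    obtain \<beta> where "\<beta> \<in> \<Phi>p" "?\<beta> = - \<beta>" using inv by (auto simp: inversion_set_def)
    then show ?thesis using eq \<rho>_pos by simp
  qed
  show "root_value (\<lambda>m. w \<rho> \<bullet> \<epsilon> m) t > 0" if "root_value \<epsilon> t \<notin> inversion_set \<Phi>p w"
    using that root pos eq \<rho>_pos by (auto simp: inversion_set_def)
qed

section \<open>The upper bound for minimal inversion complete sets\<close>

lemma card_minimal_le:
  assumes n: "n \<ge> 4" and Y: "minimal_inversion_complete \<Phi> \<Phi>p Y"
  shows "card Y \<le> n choose 2"
proof -
  have W: "Y \<subseteq> weyl_group \<Phi>" and complete: "(\<Union>w\<in>Y. inversion_set \<Phi>p w) = \<Phi>p"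
    using Y by (auto simp: minimal_inversion_complete_def inversion_complete_def)
  define N where "N w = inversion_set \<Phi>p w" for w
  \<comment> \<open>Removing \<open>w\<close> leaves some root uncovered, and that root is inverted
    by \<open>w\<close> alone.\<close>
  have "\<exists>t\<in>root_labels n. \<forall>v\<in>Y. root_value \<epsilon> t \<in> N v \<longleftrightarrow> v = w" if w: "w \<in> Y" for w
  proof -
    have "\<not> inversion_complete \<Phi> \<Phi>p (Y - {w})"
      using Y w unfolding minimal_inversion_complete_def by blast
    then have "(\<Union>v\<in>Y - {w}. N v) \<noteq> \<Phi>p"
      using W unfolding inversion_complete_def N_def by blast
    moreover have "(\<Union>v\<in>Y - {w}. N v) \<subseteq> \<Phi>p"
      unfolding N_def inversion_set_def by blast
    ultimately obtain \<beta> where "\<beta> \<in> \<Phi>p" "\<beta> \<notin> (\<Union>v\<in>Y - {w}. N v)" by blast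
    moreover from this have "\<beta> \<in> N w"
      using complete unfolding N_def by blast
    ultimately show ?thesis
      unfolding D_pos_roots_image by blast
  qed
  then obtain f where f: "\<And>w. w \<in> Y \<Longrightarrow> f w \<in> root_labels n"
    "\<And>w v. w \<in> Y \<Longrightarrow> v \<in> Y \<Longrightarrow> root_value \<epsilon> (f w) \<in> N v \<longleftrightarrow> v = w"
    by metis
  have inj: "inj_on f Y"
    using f(2) by (metis inj_onI)
  interpret separated_labels n "f ` Y"
  proof
    show "f ` Y \<subseteq> root_labels n" using f(1) by blast
    fix t assume t: "t \<in> root_labels n"
    then have "root_value \<epsilon> t \<in> (\<Union>w\<in>Y. N w)"
      using complete by (simp add: N_def D_pos_roots_image)
    then obtain w where w: "w \<in> Y" "root_value \<epsilon> t \<in> N w" by blast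
    \<comment> \<open>The exempt label for \<open>t\<close> is \<open>f w\<close>, the only private
      label whose root \<open>w\<close> inverts.\<close>
    let ?c = "\<lambda>m. w \<rho> \<bullet> \<epsilon> m"
    have "root_value ?c t < 0"
      using inversion_value(1)[of w t] w W t by (auto simp: N_def)
    moreover have "root_value ?c y > 0" if y: "y \<in> f ` Y - {f w}" for y
    proof -
      obtain v where "v \<in> Y" "y = f v" "v \<noteq> w" using y by blast
      then show ?thesis
        using inversion_value(2)[of w y] f w W by (auto simp: N_def)
    qed
    ultimately show "\<exists>c :: nat \<Rightarrow> real. \<exists>x. root_value c t < 0 \<and> (\<forall>y\<in>f ` Y - {x}. root_value c y > 0)"
      by blast
  qed
  show ?thesis
    using card_le[OF n] card_image[OF inj] by simp
qed

section \<open>Elements with prescribed coordinates and the extremal example\<close>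

lemma inner_reflection_basis:
  assumes "is_sign s" "is_sign t" "i \<in> {1..n}" "j \<in> {1..n}" "i \<noteq> j" "m \<in> {1..n}"
  shows "root_reflection (signed_root s i t j) v \<bullet> \<epsilon> m =
    (if m \<in> {i, j} then - (s * t) else 1) * (v \<bullet> \<epsilon> (transposition i j m))"
proof -
  let ?r = "root_reflection (signed_root s i t j)"
  have "?r v \<bullet> \<epsilon> m = ?r (?r v) \<bullet> ?r (\<epsilon> m)"
    by (simp only: inner_root_reflection)
  then show ?thesis
    using assms by (simp add: root_reflection_involutive root_reflection_basis)
qed

lemma swap_in_weyl_group:
  assumes "i \<in> {1..n}" "j \<in> {1..n}"
  obtains w where "w \<in> weyl_group \<Phi>"
    "\<And>v m. m \<in> {1..n} \<Longrightarrow> w v \<bullet> \<epsilon> m = v \<bullet> \<epsilon> (transposition i j m)"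
proof (cases "i = j")
  \<comment> \<open>Equal indices can occur in \<open>pair_element\<close>, and then there is no
    root to reflect in.\<close>
  case True
  then show thesis using that[OF weyl_group.weyl_id] by simp
next
  case False
  let ?\<alpha> = "signed_root 1 i (- 1) j"
  have "?\<alpha> \<in> \<Phi>" using assms False unfolding D_roots_signed is_sign_def by blast
  then show thesis
    using assms False
    by (intro that[of "root_reflection ?\<alpha>"] weyl_group.weyl_reflection)
      (simp_all add: inner_reflection_basis is_sign_def)
qed

text \<open>The reflections in \<open>\<epsilon> i + \<epsilon> j\<close> and
  \<open>\<epsilon> i - \<epsilon> j\<close> both swap the two coordinates, the first with a sign
  change; their product keeps only the signs.\<close>

lemma double_sign_in_weyl_group:
  assumes "i \<in> {1..n}" "j \<in> {1..n}" "i \<noteq> j"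
  obtains w where "w \<in> weyl_group \<Phi>"
    "\<And>v m. m \<in> {1..n} \<Longrightarrow> w v \<bullet> \<epsilon> m = (if m \<in> {i, j} then - 1 else 1) * (v \<bullet> \<epsilon> m)"
proof -
  let ?\<alpha> = "signed_root 1 i (- 1) j" and ?\<beta> = "signed_root 1 i 1 j"
  have "?\<alpha> \<in> \<Phi>" "?\<beta> \<in> \<Phi>" using assms unfolding D_roots_signed is_sign_def by blast+
  then have "root_reflection ?\<alpha> \<circ> root_reflection ?\<beta> \<in> weyl_group \<Phi>"
    by (intro weyl_group.intros)
  moreover have "transposition i j m \<in> {1..n}" if "m \<in> {1..n}" for m
    using that assms by (auto simp: transposition_def)
  ultimately show thesis
    using assms that[of "root_reflection ?\<alpha> \<circ> root_reflection ?\<beta>"]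
    by (auto simp: inner_reflection_basis is_sign_def transposition_def)
qed

text \<open>The last two coordinates of \<open>\<rho>\<close> are 1 and 0, the others at least 2.
  Swaps bring the 1 to \<open>k\<close> and the 0 to \<open>l\<close>; of the two simultaneous sign
  changes, the one at \<open>l\<close> falls on the 0 and has no effect.\<close>

lemma pair_element:
  assumes kl: "1 \<le> k" "k < l" "l \<le> n"
  shows "\<exists>w\<in>weyl_group \<Phi>. w \<rho> \<bullet> \<epsilon> k = - 1 \<and> w \<rho> \<bullet> \<epsilon> l = 0
    \<and> (\<forall>m\<in>{1..n} - {k, l}. w \<rho> \<bullet> \<epsilon> m \<ge> 2)"
proof -
  \<comment> \<open>The image of \<open>k\<close> under the swap of \<open>n\<close> and
    \<open>l\<close> (in fact \<open>k\<close> itself, as \<open>k < l\<close>). Swapping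
    \<open>n - 1\<close> and \<open>k'\<close> afterwards takes \<open>k\<close> to
    \<open>n - 1\<close> and leaves \<open>n\<close>, the image of \<open>l\<close>, fixed.\<close>
  define k' where "k' = transposition n l k"
  have k': "k' \<in> {1..n}" "k' \<noteq> n"
    using kl by (auto simp: k'_def transposition_def)
  obtain w1 where w1: "w1 \<in> weyl_group \<Phi>"
    "\<And>v m. m \<in> {1..n} \<Longrightarrow> w1 v \<bullet> \<epsilon> m = v \<bullet> \<epsilon> (transposition (n - 1) k' m)"
    by (rule swap_in_weyl_group[of "n - 1" k']) (use kl k' in auto)
  obtain w2 where w2: "w2 \<in> weyl_group \<Phi>"
    "\<And>v m. m \<in> {1..n} \<Longrightarrow> w2 v \<bullet> \<epsilon> m = v \<bullet> \<epsilon> (transposition n l m)"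
    by (rule swap_in_weyl_group[of n l]) (use kl in auto)
  obtain w3 where w3: "w3 \<in> weyl_group \<Phi>"
    "\<And>v m. m \<in> {1..n} \<Longrightarrow> w3 v \<bullet> \<epsilon> m = (if m \<in> {k, l} then - 1 else 1) * (v \<bullet> \<epsilon> m)"
    by (rule double_sign_in_weyl_group[of k l]) (use kl in auto)
  \<comment> \<open>Coordinate \<open>m\<close> after \<open>w1\<close> and then \<open>w2\<close>
    is the original coordinate \<open>\<pi> m\<close>: the index swaps compose in the opposite
    order.\<close>
  define \<pi> where "\<pi> m = transposition (n - 1) k' (transposition n l m)" for m
  have \<pi>_in: "\<pi> m \<in> {1..n}" and t_in: "transposition n l m \<in> {1..n}" if "m \<in> {1..n}" for m
    using that kl k' by (auto simp: \<pi>_def transposition_def)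
  have inj: "\<pi> m = \<pi> m' \<Longrightarrow> m = m'" for m m'
    unfolding \<pi>_def by (metis transpose_involutory)
  have \<pi>: "\<pi> k = n - 1" "\<pi> l = n"
    using kl k' by (simp_all add: \<pi>_def k'_def[symmetric] transpose_eq_iff)
  have val: "(w3 \<circ> (w2 \<circ> w1)) \<rho> \<bullet> \<epsilon> m = (if m \<in> {k, l} then - 1 else 1) * real (n - \<pi> m)"
    if "m \<in> {1..n}" for m
    using that t_in[OF that] \<rho>_basis[OF \<pi>_in[OF that]] by (simp add: w1 w2 w3 \<pi>_def)
  have "w3 \<circ> (w2 \<circ> w1) \<in> weyl_group \<Phi>"
    using w1 w2 w3 by (intro weyl_group.weyl_comp)
  moreover have "real (n - \<pi> m) \<ge> 2" if "m \<in> {1..n} - {k, l}" for m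
  proof -
    have "\<pi> m \<noteq> n" "\<pi> m \<noteq> n - 1" "\<pi> m \<in> {1..n}"
      using that inj \<pi> \<pi>_in by (metis Diff_iff insertCI)+
    then show ?thesis by auto
  qed
  ultimately show ?thesis
    using kl \<pi> val by (intro bexI[of _ "w3 \<circ> (w2 \<circ> w1)"]) (auto simp del: o_apply)
qed

lemma exists_minimal:
  "\<exists>Y. minimal_inversion_complete \<Phi> \<Phi>p Y \<and> card Y = n choose 2"
proof -
  define I where "I = {(k, l). 1 \<le> k \<and> k < l \<and> l \<le> n}"
  obtain w where w: "\<And>k l. (k, l) \<in> I \<Longrightarrow> w (k, l) \<in> weyl_group \<Phi> \<and> w (k, l) \<rho> \<bullet> \<epsilon> k = - 1
      \<and> w (k, l) \<rho> \<bullet> \<epsilon> l = 0 \<and> (\<forall>m\<in>{1..n} - {k, l}. w (k, l) \<rho> \<bullet> \<epsilon> m \<ge> 2)"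
  proof -
    define Q where "Q = (\<lambda>(k, l) w. w \<in> weyl_group \<Phi> \<and> w \<rho> \<bullet> \<epsilon> k = - 1 \<and> w \<rho> \<bullet> \<epsilon> l = 0
      \<and> (\<forall>m\<in>{1..n} - {k, l}. w \<rho> \<bullet> \<epsilon> m \<ge> 2))"
    have "\<forall>p\<in>I. \<exists>w. Q p w"
    proof clarify
      fix k l assume "(k, l) \<in> I"
      then show "\<exists>w. Q (k, l) w"
        using pair_element[of k l] unfolding I_def Q_def prod.case by blast
    qed
    then obtain w where "\<forall>p\<in>I. Q p (w p)"
      by (rule bchoice[THEN exE])
    then have "Q (k, l) (w (k, l))" if "(k, l) \<in> I" for k l
      using that by blast
    then show thesis
      unfolding Q_def prod.case by (rule that)
  qed
  \<comment> \<open>Coordinate \<open>l\<close> is 0, so either sign \<open>s\<close> gives the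
    value -1.\<close>
  have covers: "root_value \<epsilon> (k, l, s) \<in> inversion_set \<Phi>p (w (k, l))" if "(k, l) \<in> I" for k l s
  proof (rule ccontr)
    assume "\<not> ?thesis"
    then have "root_value (\<lambda>m. w (k, l) \<rho> \<bullet> \<epsilon> m) (k, l, s) > 0"
      using that w by (intro inversion_value(2)) (auto simp: I_def)
    then show False using w[OF that] by (cases s) auto
  qed
  have only: "q = (k, l)" if kl: "(k, l) \<in> I" and q: "q \<in> I"
    and inv: "root_value \<epsilon> (k, l, True) \<in> inversion_set \<Phi>p (w q)" for k l q
  proof -
    obtain i j where q_eq: "q = (i, j)" by (cases q)
    have ij: "(i, j) \<in> I" using q q_eq by simp
    define c where "c m = w q \<rho> \<bullet> \<epsilon> m" for m
    have c: "c i = - 1" "c j = 0" "\<And>m. m \<in> {1..n} - {i, j} \<Longrightarrow> c m \<ge> 2"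
      using w[OF ij] by (auto simp: c_def q_eq)
    have "root_value c (k, l, True) < 0"
      unfolding c_def using kl ij w inv by (intro inversion_value(1)) (auto simp: I_def q_eq)
    then have neg: "c k + c l < 0" by simp
    \<comment> \<open>No coordinate is below -1, so an index outside \<open>{i, j}\<close>, with
      coordinate at least 2, would make the sum positive.\<close>
    have ge: "c m \<ge> - 1" if "m \<in> {1..n}" for m
      using c that by (cases "m = i \<or> m = j") (auto intro: order_trans[of _ 2])
    have in_range: "k \<in> {1..n}" "l \<in> {1..n}" and "k < l" "i < j"
      using kl ij by (auto simp: I_def)
    moreover have "k \<in> {i, j}"
    proof (rule ccontr)
      assume "k \<notin> {i, j}"
      then have "c k \<ge> 2" using c(3)[of k] in_range by blast
      then show False using neg ge[of l] in_range by linarith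
    qed
    moreover have "l \<in> {i, j}"
    proof (rule ccontr)
      assume "l \<notin> {i, j}"
      then have "c l \<ge> 2" using c(3)[of l] in_range by blast
      then show False using neg ge[of k] in_range by linarith
    qed
    ultimately show ?thesis by (auto simp: q_eq)
  qed
  have inj: "inj_on w I"
  proof (rule inj_onI)
    fix p q assume pq: "p \<in> I" "q \<in> I" "w p = w q"
    obtain k l where p: "p = (k, l)" by (cases p)
    show "p = q"
      using only[of k l q] covers[of k l True] pq by (simp add: p)
  qed
  have complete: "inversion_complete \<Phi> \<Phi>p (w ` I)"
  proof -
    have "w ` I \<subseteq> weyl_group \<Phi>" using w by auto
    moreover have "\<Phi>p \<subseteq> (\<Union>v\<in>w ` I. inversion_set \<Phi>p v)"
    proof
      fix \<beta> assume "\<beta> \<in> \<Phi>p"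
      then obtain k l s where "(k, l) \<in> I" "\<beta> = root_value \<epsilon> (k, l, s)"
        by (auto simp: D_pos_roots_image I_def simp del: root_value.simps)
      then show "\<beta> \<in> (\<Union>v\<in>w ` I. inversion_set \<Phi>p v)"
        using covers by blast
    qed
    moreover have "(\<Union>v\<in>w ` I. inversion_set \<Phi>p v) \<subseteq> \<Phi>p"
      by (auto simp: inversion_set_def)
    ultimately show ?thesis by (auto simp: inversion_complete_def)
  qed
  \<comment> \<open>A proper subset omits some \<open>w (k, l)\<close>, and then
    \<open>\<epsilon> k + \<epsilon> l\<close> is left uncovered.\<close>
  have "\<not> inversion_complete \<Phi> \<Phi>p Z" if Z: "Z \<subset> w ` I" for Z
  proof
    assume "inversion_complete \<Phi> \<Phi>p Z"
    obtain k l where kl: "(k, l) \<in> I" "w (k, l) \<notin> Z" using Z by auto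
    then have "root_value \<epsilon> (k, l, True) \<in> \<Phi>p"
      by (auto simp: D_pos_roots_image I_def simp del: root_value.simps)
    then obtain v where "v \<in> Z" "root_value \<epsilon> (k, l, True) \<in> inversion_set \<Phi>p v"
      using \<open>inversion_complete \<Phi> \<Phi>p Z\<close> unfolding inversion_complete_def by blast
    then show False using only[OF kl(1)] kl(2) Z by blast
  qed
  with complete have "minimal_inversion_complete \<Phi> \<Phi>p (w ` I)"
    by (simp add: minimal_inversion_complete_def)
  moreover have "card (w ` I) = n choose 2"
  proof -
    have "bij_betw (\<lambda>(k, l). {k, l}) I {B. B \<subseteq> {1..n} \<and> card B = 2}"
    proof (rule bij_betw_imageI)
      show "inj_on (\<lambda>(k, l). {k, l}) I"
        by (auto simp: inj_on_def I_def doubleton_eq_iff)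
      have "B \<in> (\<lambda>(k, l). {k, l}) ` I" if B: "B \<subseteq> {1..n}" "card B = 2" for B
      proof -
        obtain a b where ab: "B = {a, b}" "a \<noteq> b" using B by (auto simp: card_2_iff)
        with B have "(min a b, max a b) \<in> I" by (auto simp: I_def min_def max_def)
        moreover have "B = {min a b, max a b}" using ab by (auto simp: min_def max_def)
        ultimately show ?thesis by force
      qed
      then show "(\<lambda>(k, l). {k, l}) ` I = {B. B \<subseteq> {1..n} \<and> card B = 2}"
        by (auto simp: I_def)
    qed
    then have "card I = n choose 2"
      using n_subsets[of "{1..n}" 2] bij_betw_same_card by fastforce
    with inj show ?thesis by (simp add: card_image)
  qed
  ultimately show ?thesis by blast
qed

lemma MC_eq:
  assumes "n \<ge> 4"
  shows "MC \<Phi> \<Phi>p = n choose 2"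
  unfolding MC_def
proof (rule Max_eqI)
  \<comment> \<open>The upper bound also gives the finiteness that \<open>Max\<close>
    requires.\<close>
  have "{card Y | Y. minimal_inversion_complete \<Phi> \<Phi>p Y} \<subseteq> {..n choose 2}"
    using card_minimal_le[OF assms] by auto
  then show "finite {card Y | Y. minimal_inversion_complete \<Phi> \<Phi>p Y}"
    by (rule finite_subset) simp
  show "m \<le> n choose 2" if "m \<in> {card Y | Y. minimal_inversion_complete \<Phi> \<Phi>p Y}" for m
    using that card_minimal_le[OF assms] by blast
  show "n choose 2 \<in> {card Y | Y. minimal_inversion_complete \<Phi> \<Phi>p Y}"
    using exists_minimal by (metis (mono_tags, lifting) mem_Collect_eq)
qed

end

theorem theorem1p3:
  fixes n :: nat and \<epsilon> :: "nat \<Rightarrow> real ^ 'n"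
  assumes "n \<ge> 4" and "CARD('n) = n" and "bij_betw \<epsilon> {1..n} Basis"
  shows "MC (D_roots n \<epsilon>) (D_pos_roots n \<epsilon>) = n choose 2"
proof -
  interpret D_system n \<epsilon>
  proof
    fix i j assume ij: "i \<in> {1..n}" "j \<in> {1..n}"
    have "\<epsilon> i \<in> Basis" "\<epsilon> j \<in> Basis" using assms(3) ij by (auto simp: bij_betw_def)
    moreover have "\<epsilon> i = \<epsilon> j \<longleftrightarrow> i = j"
      using bij_betw_imp_inj_on[OF assms(3)] ij by (rule inj_on_eq_iff)
    ultimately show "\<epsilon> i \<bullet> \<epsilon> j = (if i = j then 1 else 0)"
      by (simp add: inner_Basis)
  qed
  show ?thesis using assms(1) by (rule MC_eq)
qed

end
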